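(* Let $\mathbb{F}$ be a field with $\operatorname{char}(\mathbb{F})\neq 2$. Let $n\geq 1$ be an integer, let $G=\operatorname{Sym}(n)$ and let $D=(1\,2)^G$ be the set of all transpositions of $G$. Let $A$ be the Matsuo algebra $M_{1/2}(G,D)=M_{1/2}(\Gamma(\mathrm{A}_{n-1}))$ over $\mathbb{F}$. Then $A$ is isomorphic to the Jordan algebra of symmetric zero-sum $n\times n$ matrices over $\mathbb{F}$.
   Context: For $\alpha\in\mathbb{F}$ and a $3$-transposition group $(G,D)$ (a group $G$ generated by a conjugation-closed set $D$ of involutions with $|cd|\le 3$ for all $c,d\in D$), the Matsuo algebra $M_\alpha(G,D)$ is the commutative, not necessarily associative $\mathbb{F}$-algebra with basis $D$ and multiplication: $c\cdot c=c$; $c\cdot d=0$ if $|cd|=2$; $c\cdot d=\frac{\alpha}{2}(c+d-c^d)$ if $|cd|=3$, where $c^d=d^{-1}cd$. (This is the Matsuo algebra of the Fischer space with point set $D$ and lines $\{c,d,c^d\}$, $|cd|=3$; for $G=\operatorname{Sym}(n)$ this Fischer space is $\Gamma(\mathrm{A}_{n-1})$. For $n=1$, $D$ is empty and $A=0$.) The Jordan algebra of symmetric zero-sum $n\times n$ matrices over $\mathbb{F}$ is the space of symmetric $n\times n$ matrices over $\mathbb{F}$ all of whose row sums (hence also column sums) are $0$, with product $x\bullet y=\frac12(xy+yx)$. *)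

theory Defs
  imports
    "HOL-Algebra.Sym_Groups"
    "HOL-Algebra.Multiplicative_Group"
    "Jordan_Normal_Form.Matrix"
begin

text \<open>Not necessarily associative or unital algebras over a field \<open>'f\<close>, with an explicit carrier.\<close>

record ('f, 'v) alg =
  alg_carrier :: "'v set"
  alg_add :: "'v \<Rightarrow> 'v \<Rightarrow> 'v"
  alg_scale :: "'f \<Rightarrow> 'v \<Rightarrow> 'v"
  alg_mult :: "'v \<Rightarrow> 'v \<Rightarrow> 'v"

definition alg_iso :: "('f, 'v) alg \<Rightarrow> ('f, 'w) alg \<Rightarrow> ('v \<Rightarrow> 'w) \<Rightarrow> bool" where
  "alg_iso A B \<phi> \<longleftrightarrow>
     bij_betw \<phi> (alg_carrier A) (alg_carrier B) \<and>
     (\<forall>x\<in>alg_carrier A. \<forall>y\<in>alg_carrier A. \<phi> (alg_add A x y) = alg_add B (\<phi> x) (\<phi> y)) \<and>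
     (\<forall>a. \<forall>x\<in>alg_carrier A. \<phi> (alg_scale A a x) = alg_scale B a (\<phi> x)) \<and>
     (\<forall>x\<in>alg_carrier A. \<forall>y\<in>alg_carrier A. \<phi> (alg_mult A x y) = alg_mult B (\<phi> x) (\<phi> y))"

definition alg_isomorphic :: "('f, 'v) alg \<Rightarrow> ('f, 'w) alg \<Rightarrow> bool" where
  "alg_isomorphic A B \<longleftrightarrow> (\<exists>\<phi>. alg_iso A B \<phi>)"


section \<open>3-transposition groups and Matsuo algebras\<close>

definition conj_by :: "('g, 'b) monoid_scheme \<Rightarrow> 'g \<Rightarrow> 'g \<Rightarrow> 'g" where
  "conj_by G c d = inv\<^bsub>G\<^esub> d \<otimes>\<^bsub>G\<^esub> c \<otimes>\<^bsub>G\<^esub> d"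

text \<open>Since \<^const>\<open>group.ord\<close> is 0 on elements of infinite order, \<open>|cd| \<le> 3\<close> reads
  \<open>1 \<le> ord (cd) \<le> 3\<close>.\<close>

locale three_transposition_group = group G for G (structure) +
  fixes D
  assumes D_subset: "D \<subseteq> carrier G"
    and D_generates: "generate G D = carrier G"
    and D_conj_closed: "\<lbrakk>c \<in> D; g \<in> carrier G\<rbrakk> \<Longrightarrow> conj_by G c g \<in> D"
    and D_involution: "c \<in> D \<Longrightarrow> ord c = 2"
    and D_ord: "\<lbrakk>c \<in> D; d \<in> D\<rbrakk> \<Longrightarrow> ord (c \<otimes> d) \<in> {1, 2, 3}"

text \<open>The vector space with basis \<open>D\<close> is realised as the finitely supported functions vanishing
  outside \<open>D\<close>; \<open>matsuo_basis c\<close> is the basis vector \<open>c\<close>.\<close>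

definition matsuo_carrier :: "'g set \<Rightarrow> ('g \<Rightarrow> 'f::field) set" where
  "matsuo_carrier D = {x. finite {c. x c \<noteq> 0} \<and> (\<forall>c. c \<notin> D \<longrightarrow> x c = 0)}"

definition matsuo_basis :: "'g \<Rightarrow> 'g \<Rightarrow> 'f::field" where
  "matsuo_basis c = (\<lambda>g. if g = c then 1 else 0)"

definition matsuo_basis_mult ::
    "'f::field \<Rightarrow> ('g, 'b) monoid_scheme \<Rightarrow> 'g \<Rightarrow> 'g \<Rightarrow> ('g \<Rightarrow> 'f)" where
  "matsuo_basis_mult \<alpha> G c d =
     (if c = d then matsuo_basis c
      else if group.ord G (c \<otimes>\<^bsub>G\<^esub> d) = 3
      then (\<lambda>g. \<alpha> / 2 * (matsuo_basis c g + matsuo_basis d g - matsuo_basis (conj_by G c d) g))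
      else (\<lambda>_. 0))"

definition matsuo_algebra ::
    "'f::field \<Rightarrow> ('g, 'b) monoid_scheme \<Rightarrow> 'g set \<Rightarrow> ('f, 'g \<Rightarrow> 'f) alg" where
  "matsuo_algebra \<alpha> G D =
     \<lparr>alg_carrier = matsuo_carrier D,
      alg_add = (\<lambda>x y g. x g + y g),
      alg_scale = (\<lambda>a x g. a * x g),
      alg_mult = (\<lambda>x y g. \<Sum>c | x c \<noteq> 0. \<Sum>d | y d \<noteq> 0. x c * y d * matsuo_basis_mult \<alpha> G c d g)\<rparr>"

lemma matsuo_algebra_mult_basis:
  "alg_mult (matsuo_algebra \<alpha> G D) (matsuo_basis c) (matsuo_basis d) = matsuo_basis_mult \<alpha> G c d"
proof -
  have *: "{g. matsuo_basis e g \<noteq> (0::'h::field)} = {e}" for e :: 'k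
    by (auto simp: matsuo_basis_def)
  show ?thesis
    unfolding matsuo_algebra_def by (simp add: *) (simp add: matsuo_basis_def)
qed


section \<open>Transpositions of the symmetric group\<close>

definition transpositions :: "nat \<Rightarrow> (nat \<Rightarrow> nat) set" where
  "transpositions n = {transpose a b |a b. a \<in> {1..n} \<and> b \<in> {1..n} \<and> a \<noteq> b}"

lemma transpositions_carrier: "transpositions n \<subseteq> carrier (sym_group n)"
  by (auto simp: transpositions_def sym_group_carrier intro!: permutes_swap_id)

lemma conj_by_transpose:
  assumes "p \<in> carrier (sym_group n)" "a \<in> {1..n}" "b \<in> {1..n}"
  shows "conj_by (sym_group n) (transpose a b) p = transpose (inv' p a) (inv' p b)"
proof -
  have p: "bij p" using assms(1) by (simp add: sym_group_carrier permutes_bij)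
  have "transpose a b \<circ> p = p \<circ> transpose (inv' p a) (inv' p b)"
    using p by (auto simp: fun_eq_iff transpose_def bij_inv_eq_iff)
      (metis bij_inv_eq_iff)+
  hence "inv' p \<circ> (transpose a b \<circ> p) = transpose (inv' p a) (inv' p b)"
    using p by (metis bij_is_inj comp_assoc fun.map_id id_comp inv_o_cancel)
  thus ?thesis
    using assms(1) by (simp add: conj_by_def sym_group_mult comp_assoc)
qed

lemma transpositions_conj_class:
  assumes "n \<ge> 2"
  shows "transpositions n = conj_by (sym_group n) (transpose 1 2) ` carrier (sym_group n)"
proof (intro equalityI subsetI)
  fix t assume "t \<in> transpositions n"
  then obtain a b where ab: "a \<in> {1..n}" "b \<in> {1..n}" "a \<noteq> b" and t: "t = transpose a b"
    by (auto simp: transpositions_def)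
  define b' where "b' = transpose 1 a b"
  define q where "q = transpose 1 a \<circ> transpose 2 b'"
  have b': "b' \<in> {1..n}" "b' \<noteq> 1"
    using ab assms by (auto simp: b'_def transpose_def)
  have q: "q permutes {1..n}"
    unfolding q_def using ab b' assms by (intro permutes_compose permutes_swap_id) auto
  have "q 1 = a" "q 2 = b"
    using ab b' by (auto simp: q_def b'_def transpose_def)
  hence "t = conj_by (sym_group n) (transpose 1 2) (inv' q)"
    using conj_by_transpose[of "inv' q" n 1 2] q assms t
    by (simp add: sym_group_carrier permutes_inv permutes_inv_inv)
  thus "t \<in> conj_by (sym_group n) (transpose 1 2) ` carrier (sym_group n)"
    using q by (auto simp: sym_group_carrier permutes_inv)
next
  fix t assume "t \<in> conj_by (sym_group n) (transpose 1 2) ` carrier (sym_group n)"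
  then obtain p where p: "p permutes {1..n}"
    and t: "t = conj_by (sym_group n) (transpose 1 2) p"
    by (auto simp: sym_group_carrier)
  have "inv' p 1 \<in> {1..n}" "inv' p 2 \<in> {1..n}" "inv' p 1 \<noteq> inv' p 2"
    using p assms permutes_in_image[OF permutes_inv[OF p], of 1] permutes_in_image[OF permutes_inv[OF p], of 2]
    by (auto dest: permutes_inv_eq[OF p, THEN iffD1] simp: inj_eq[OF permutes_inj[OF permutes_inv[OF p]]])
  thus "t \<in> transpositions n"
    using t conj_by_transpose[of p n 1 2] p assms
    by (auto simp: transpositions_def sym_group_carrier)
qed

lemma three_transposition_group_sym:
  "three_transposition_group (sym_group n) (transpositions n)"
proof -
  interpret group "sym_group n" by (rule sym_group_is_group)
  have pow2: "x [^]\<^bsub>sym_group n\<^esub> (2::nat) = x \<circ> x" and pow3: "x [^]\<^bsub>sym_group n\<^esub> (3::nat) = x \<circ> x \<circ> x"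
    if "x \<in> carrier (sym_group n)" for x
    using that by (simp_all add: numeral_2_eq_2 numeral_3_eq_3 sym_group_mult sym_group_one)
  show ?thesis
  proof
    show "transpositions n \<subseteq> carrier (sym_group n)" by (rule transpositions_carrier)
    show "generate (sym_group n) (transpositions n) = carrier (sym_group n)"
    proof
      show "generate (sym_group n) (transpositions n) \<subseteq> carrier (sym_group n)"
        by (rule generate_incl[OF transpositions_carrier])
      show "carrier (sym_group n) \<subseteq> generate (sym_group n) (transpositions n)"
      proof
        fix p assume "p \<in> carrier (sym_group n)"
        hence "p permutes {1..n}" by (simp add: sym_group_carrier)
        from this finite_atLeastAtMost[of 1 n] show "p \<in> generate (sym_group n) (transpositions n)"
        proof (induction p rule: permutes_induct)
          case id
          show ?case using generate.one[of "sym_group n" "transpositions n"] by (simp only: sym_group_one)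
        next
          case (swap a b p)
          have "transpose a b \<in> transpositions n" using swap by (auto simp: transpositions_def)
          from generate.eng[OF generate.incl[OF this] swap.IH]
          show ?case by (simp only: sym_group_mult)
        qed
      qed
    qed
  next
    fix c g assume "c \<in> transpositions n" and g: "g \<in> carrier (sym_group n)"
    then obtain a b where ab: "a \<in> {1..n}" "b \<in> {1..n}" "a \<noteq> b" and c: "c = transpose a b"
      by (auto simp: transpositions_def)
    have p: "inv' g permutes {1..n}" using g by (simp add: sym_group_carrier permutes_inv)
    have "inv' g a \<in> {1..n}" "inv' g b \<in> {1..n}" "inv' g a \<noteq> inv' g b"
      using ab permutes_in_image[OF p] inj_eq[OF permutes_inj[OF p]] by blast+
    thus "conj_by (sym_group n) c g \<in> transpositions n"
      using conj_by_transpose[OF g ab(1,2)] c by (auto simp: transpositions_def)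
  next
    fix c assume c: "c \<in> transpositions n"
    then obtain a b where ab: "a \<noteq> b" "c = transpose a b" by (auto simp: transpositions_def)
    have cc: "c \<in> carrier (sym_group n)" using c transpositions_carrier by blast
    have "ord c dvd 2"
      using pow_eq_id[OF cc, of 2] pow2[OF cc] ab by (simp add: sym_group_one)
    hence "ord c \<le> 2" "ord c \<noteq> 0" by (auto dest: dvd_imp_le intro!: Nat.gr0I)
    moreover have "ord c \<noteq> 1"
      using ord_eq_1[OF cc] ab by (metis id_apply sym_group_one transpose_apply_first)
    ultimately show "ord c = 2"
      by linarith
  next
    fix c d assume cd: "c \<in> transpositions n" "d \<in> transpositions n"
    define x where "x = c \<circ> d"
    have x: "x \<in> carrier (sym_group n)"
      using cd transpositions_carrier[of n] m_closed[of c d] by (auto simp: x_def sym_group_mult)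
    obtain a b u v where c: "a \<noteq> b" "c = transpose a b" and d: "u \<noteq> v" "d = transpose u v"
      using cd by (auto simp: transpositions_def)
    have share: "transpose p q \<circ> transpose q r \<circ> (transpose p q \<circ> transpose q r) \<circ>
        (transpose p q \<circ> transpose q r) = id" if "p \<noteq> q" "q \<noteq> r" for p q r :: nat
      using that by (auto simp: fun_eq_iff transpose_def)
    have "x \<circ> x = id \<or> x \<circ> x \<circ> x = id"
    proof (cases "{a, b} \<inter> {u, v} = {}")
      case True
      thus ?thesis unfolding x_def c d by (auto simp: fun_eq_iff transpose_def)
    next
      case False
      hence "b = u \<or> b = v \<or> a = u \<or> a = v" by auto
      thus ?thesis
        using share[of a b v] share[of a b u] share[of b a v] share[of b a u] c d
        unfolding x_def by (elim disjE) (simp_all only: transpose_commute not_sym simp_thms)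
    qed
    hence "ord x dvd 2 \<or> ord x dvd 3"
      using pow_eq_id[OF x, of 2] pow_eq_id[OF x, of 3] pow2[OF x] pow3[OF x] by (auto simp: sym_group_one)
    hence "ord x \<le> 3" "ord x \<noteq> 0" by (auto dest: dvd_imp_le intro!: Nat.gr0I)
    hence "ord x \<in> {1, 2, 3}" by auto
    thus "ord (c \<otimes>\<^bsub>sym_group n\<^esub> d) \<in> {1, 2, 3}" by (simp add: x_def sym_group_mult)
  qed
qed


section \<open>Symmetric zero-sum matrices\<close>

definition zero_sum_sym_mats :: "nat \<Rightarrow> 'f::field mat set" where
  "zero_sum_sym_mats n =
     {X \<in> carrier_mat n n. transpose_mat X = X \<and> (\<forall>i<n. (\<Sum>j<n. X $$ (i, j)) = 0)}"

definition zero_sum_jordan_algebra :: "nat \<Rightarrow> ('f::field, 'f mat) alg" where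
  "zero_sum_jordan_algebra n =
     \<lparr>alg_carrier = zero_sum_sym_mats n,
      alg_add = (+),
      alg_scale = (\<cdot>\<^sub>m),
      alg_mult = (\<lambda>X Y. (1 / 2) \<cdot>\<^sub>m (X * Y + Y * X))\<rparr>"

end

theory Submission
  imports Defs
begin

text \<open>The isomorphism sends a transposition \<open>c\<close> to \<open>(1 - M c) / 2\<close>, where \<open>M c\<close> is its permutation
  matrix; for \<open>c = (a b)\<close> this is half the square of the vector \<open>e\<^sub>a - e\<^sub>b\<close>. Multiplicativity amounts
  to the identities \<open>1 - M c - M d + M (c d) = 0\<close> for disjoint \<open>c\<close>, \<open>d\<close> and
  \<open>1 - M c - M d - M (c d c) + M (c d) + M (d c) = 0\<close> for \<open>c\<close>, \<open>d\<close> moving a common point (the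
  alternating sum over \<open>Sym(3)\<close> annihilates the permutation module on three points). Since \<open>c = (a b)\<close>
  is the only transposition contributing to the entry at \<open>a, b\<close>, a symmetric zero-sum matrix is
  the image of exactly one vector, read off from its off-diagonal entries.\<close>

definition axis_entry :: "(nat \<Rightarrow> nat) \<Rightarrow> nat \<Rightarrow> nat \<Rightarrow> 'f::field" where
  "axis_entry c i j = (of_bool (i = j) - of_bool (c i = j)) / 2"

text \<open>Matrices are indexed from 0, whereas \<open>sym_group n\<close> acts on \<open>{1..n}\<close>.\<close>

definition matsuo_to_mat :: "nat \<Rightarrow> ((nat \<Rightarrow> nat) \<Rightarrow> 'f::field) \<Rightarrow> 'f mat" where
  "matsuo_to_mat n x =
     mat n n (\<lambda>(i, j). \<Sum>c\<in>transpositions n. x c * axis_entry c (Suc i) (Suc j))"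

lemma two_neq_zero: "CHAR('f::field) \<noteq> 2 \<Longrightarrow> (2 :: 'f) \<noteq> 0"
proof
  assume "CHAR('f) \<noteq> 2" "(2 :: 'f) = 0"
  from this(2) have "of_nat 2 = (0 :: 'f)" by simp
  hence "CHAR('f) dvd 2" by (simp only: of_nat_eq_0_iff_char_dvd)
  hence "CHAR('f) \<noteq> 0" "CHAR('f) \<le> 2" using dvd_imp_le[of "CHAR('f)" 2]
      dvd_0_left[of "2 :: nat"] by (metis zero_neq_numeral, simp)
  moreover have "CHAR('f) \<noteq> 1" by simp
  ultimately show False using \<open>CHAR('f) \<noteq> 2\<close> by linarith
qed

section \<open>Transpositions and their action on points\<close>

lemma finite_transpositions: "finite (transpositions n)"
  by (rule finite_subset[OF _ finite_permutations[of "{1..n}"]])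
    (use transpositions_carrier[of n] in \<open>auto simp: sym_group_carrier\<close>)

lemma transpositions_permutes: "c \<in> transpositions n \<Longrightarrow> c permutes {1..n}"
  using transpositions_carrier[of n] by (auto simp: sym_group_carrier)

lemma transpositions_involuntory: "c \<in> transpositions n \<Longrightarrow> c (c i) = i"
  by (auto simp: transpositions_def)

lemma transpositions_eq_transpose:
  assumes "c \<in> transpositions n" "c i = j" "i \<noteq> j"
  shows "c = transpose i j"
  using assms by (auto simp: transpositions_def transpose_def split: if_splits)

lemma sum_lessThan_Suc_of_bool:
  assumes "m \<in> {1..n}"
  shows "(\<Sum>k<n. of_bool (m = Suc k) * f (Suc k)) = (f m :: 'f::field)"
proof -
  have "(\<Sum>k<n. of_bool (m = Suc k) * f (Suc k)) = (\<Sum>k<n. if k = m - 1 then f m else 0)"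
    using assms by (intro sum.cong) auto
  also have "\<dots> = f m" using assms by simp linarith
  finally show ?thesis .
qed

text \<open>Row i of the matrix of c is half the difference of the unit rows at i and c i. Applied
  to a column f this evaluates matrix products, and applied to f = 1 it gives the row sums.\<close>

lemma sum_axis_entry_mult:
  assumes "c \<in> transpositions n" "i \<in> {1..n}"
  shows "(\<Sum>k<n. axis_entry c i (Suc k) * f (Suc k)) = ((f i - f (c i)) / 2 :: 'f::field)"
proof -
  have ci: "c i \<in> {1..n}"
    using permutes_in_image[OF transpositions_permutes[OF assms(1)]] assms(2) by blast
  have "(\<Sum>k<n. axis_entry c i (Suc k) * f (Suc k)) =
     ((\<Sum>k<n. of_bool (i = Suc k) * f (Suc k)) - (\<Sum>k<n. of_bool (c i = Suc k) * f (Suc k))) / 2"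
    by (simp add: axis_entry_def sum_divide_distrib left_diff_distrib flip: sum_subtractf
        del: sum_of_bool_mult_eq sum_mult_of_bool_eq)
  thus ?thesis
    by (simp add: sum_lessThan_Suc_of_bool[OF assms(2)] sum_lessThan_Suc_of_bool[OF ci])
qed

lemma axis_entry_sym: "c \<in> transpositions n \<Longrightarrow> axis_entry c i j = axis_entry c j i"
  using transpositions_involuntory[of c n] by (auto simp: axis_entry_def of_bool_def)

text \<open>The order of c d is 1, 2 or 3, and for involutions (c d)^2 = 1 says that c and d
  commute. This trades the order test in \<open>matsuo_basis_mult\<close> for a condition that can
  be checked on points.\<close>

lemma ord_eq_3_iff_not_commute:
  assumes "c \<in> transpositions n" "d \<in> transpositions n"
  shows "group.ord (sym_group n) (c \<otimes>\<^bsub>sym_group n\<^esub> d) = 3 \<longleftrightarrow> c \<circ> d \<noteq> d \<circ> c"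
proof -
  interpret three_transposition_group "sym_group n" "transpositions n"
    by (rule three_transposition_group_sym)
  have cd: "c \<otimes>\<^bsub>sym_group n\<^esub> d \<in> carrier (sym_group n)"
    using assms D_subset by blast
  have "ord (c \<otimes>\<^bsub>sym_group n\<^esub> d) dvd 2 \<longleftrightarrow> (c \<circ> d) \<circ> (c \<circ> d) = id"
    using pow_eq_id[OF cd, of 2] cd
    by (simp add: numeral_2_eq_2 sym_group_mult sym_group_one)
  also have "\<dots> \<longleftrightarrow> c \<circ> d = d \<circ> c"
    using assms[THEN transpositions_involuntory] by (auto simp: fun_eq_iff) metis+
  finally show ?thesis using D_ord[OF assms] by auto
qed

section \<open>Products of two basis vectors\<close>

lemma sum_matsuo_basis_mult:
  assumes "finite A" "c \<in> A"
  shows "(\<Sum>e\<in>A. matsuo_basis c e * f e) = (f c :: 'f::field)"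
  using assms by (simp add: matsuo_basis_def if_distrib[of "\<lambda>x. x * _"] cong: if_cong)

text \<open>Multiplicativity on basis vectors, entry by entry: by \<open>sum_axis_entry_mult\<close>
  the left side is the (i, j) entry of the Jordan product of the matrices of c and d.\<close>

lemma axis_entry_jordan_mult:
  fixes c d :: "nat \<Rightarrow> nat"
  assumes two: "(2 :: 'f::field) \<noteq> 0"
    and c: "c \<in> transpositions n" and d: "d \<in> transpositions n"
  shows "((axis_entry d i j - axis_entry d (c i) j) / 2 + (axis_entry c i j - axis_entry c (d i) j) / 2) / 2 =
    (\<Sum>e\<in>transpositions n. matsuo_basis_mult (1 / 2) (sym_group n) c d e * (axis_entry e i j :: 'f))"
    (is "_ = ?R")
proof -
  note B = sum_matsuo_basis_mult[OF finite_transpositions]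
  consider "c = d" | "c \<noteq> d" "c \<circ> d = d \<circ> c" | "c \<circ> d \<noteq> d \<circ> c" by blast
  thus ?thesis
  proof cases
    case 1
    hence R: "?R = axis_entry c i j" using B[OF c] by (simp add: matsuo_basis_mult_def)
    have half: "(p + p) / 2 = p" for p :: 'f using two by (simp flip: mult_2)
    \<comment> \<open>Rows i and d i are opposite, which makes the matrix of d idempotent.\<close>
    have "axis_entry d (d i) j = - (axis_entry d i j :: 'f)"
      using transpositions_involuntory[OF d] by (simp add: axis_entry_def minus_divide_left)
    thus ?thesis unfolding R unfolding 1 using two by (simp add: half)
  next
    case 2
    hence R: "?R = 0" using ord_eq_3_iff_not_commute[OF c d] by (simp add: matsuo_basis_mult_def)
    obtain a b u v where ab: "a \<noteq> b" "c = transpose a b" and uv: "u \<noteq> v" "d = transpose u v"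
      using c d by (auto simp: transpositions_def)
    have comm: "c (d x) = d (c x)" for x using 2 by (simp add: fun_eq_iff)
    \<comment> \<open>Commuting makes c preserve {u, v}; a common point would be moved by c within
      this pair, forcing c = d.\<close>
    have dis: "a \<noteq> u" "a \<noteq> v" "b \<noteq> u" "b \<noteq> v"
      using comm[of a] comm[of b] comm[of u] comm[of v] 2(1) ab uv
      by (auto simp: transpose_def split: if_splits)
    show ?thesis unfolding R using ab uv dis two
      by (auto simp: axis_entry_def transpose_def)
  next
    case 3
    \<comment> \<open>Transpositions that do not commute share exactly one point, here named
      b.\<close>
    obtain a b v where ab: "a \<noteq> b" "b \<noteq> v" "a \<noteq> v" and ce: "c = transpose a b" and de: "d = transpose b v"
    proof -
      obtain a b u v where *: "a \<noteq> b" "c = transpose a b" "u \<noteq> v" "d = transpose u v"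
        using c d by (auto simp: transpositions_def)
      have "c \<circ> d = d \<circ> c" if "{a, b} \<inter> {u, v} = {}"
        unfolding * using that by (auto simp: fun_eq_iff transpose_def)
      hence "{a, b} \<inter> {u, v} \<noteq> {}" using 3 by blast
      hence "b = u \<or> b = v \<or> a = u \<or> a = v" by auto
      moreover have "c \<noteq> d" using 3 by auto
      ultimately show thesis
        using that[of a b v] that[of a b u] that[of b a v] that[of b a u] *
        by (elim disjE) (metis transpose_commute)+
    qed
    note perm = c[THEN transpositions_permutes] d[THEN transpositions_permutes]
    have in_n: "a \<in> {1..n}" "b \<in> {1..n}" "v \<in> {1..n}"
      using permutes_not_in[OF perm(1), of a] permutes_not_in[OF perm(1), of b]
        permutes_not_in[OF perm(2), of v] ab by (auto simp: ce de)
    have cdc: "conj_by (sym_group n) c d = transpose a v"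
      using conj_by_transpose[of d n a b] in_n perm ab by (simp add: ce de sym_group_carrier)
    have cdT: "transpose a v \<in> transpositions n"
      using in_n ab by (auto simp: transpositions_def)
    have "c \<noteq> d" using 3 by auto
    \<comment> \<open>The factor 1/4 is \<alpha>/2 at \<alpha> = 1/2.\<close>
    hence "?R = (\<Sum>e\<in>transpositions n. 1 / 4 * (matsuo_basis c e * axis_entry e i j +
        matsuo_basis d e * axis_entry e i j - matsuo_basis (transpose a v) e * axis_entry e i j))"
      using 3 ord_eq_3_iff_not_commute[OF c d]
      by (intro sum.cong refl)
        (simp add: matsuo_basis_mult_def cdc ring_distribs diff_divide_distrib add_divide_distrib)
    hence R: "?R = 1 / 4 * (axis_entry c i j + axis_entry d i j - axis_entry (transpose a v) i j)"
      by (simp only: sum_distrib_left[symmetric] sum.distrib sum_subtractf B[OF c] B[OF d] B[OF cdT])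
    \<comment> \<open>This is row i of the Sym(3) identity: 1, c d, d c and c, d, (a v) send i to
      the same three points, counted with multiplicity. For i in {a, b, v} each triple of images
      lists a, b, v once; any other i is fixed by all six.\<close>
    have "axis_entry (transpose a v) i j = axis_entry d (c i) j + (axis_entry c (d i) j :: 'f)"
    proof -
      consider "i = a" | "i = b" | "i = v" | "i \<notin> {a, b, v}" by blast
      thus ?thesis
        by cases (use ab in \<open>simp_all add: axis_entry_def ce de transpose_apply_other
          diff_divide_distrib\<close>)
    qed
    thus ?thesis unfolding R by (simp add: diff_divide_distrib add_divide_distrib)
  qed
qed

section \<open>Multiplicativity on arbitrary vectors\<close>

text \<open>Enlarging the supports of x and y to one fixed finite index set adds only zero terms and
  lets the sums be exchanged.\<close>

lemma matsuo_algebra_mult_eq: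
  assumes "x \<in> matsuo_carrier (transpositions n)" "y \<in> matsuo_carrier (transpositions n)"
  shows "alg_mult (matsuo_algebra \<alpha> G (transpositions n)) x y =
    (\<lambda>g. \<Sum>c\<in>transpositions n. \<Sum>d\<in>transpositions n. x c * y d * matsuo_basis_mult \<alpha> G c d g)"
proof
  fix g
  have "alg_mult (matsuo_algebra \<alpha> G (transpositions n)) x y g =
     (\<Sum>c | x c \<noteq> 0. \<Sum>d\<in>transpositions n. x c * y d * matsuo_basis_mult \<alpha> G c d g)"
    unfolding matsuo_algebra_def alg.simps using assms finite_transpositions[of n]
    by (intro sum.cong refl sum.mono_neutral_left) (auto simp: matsuo_carrier_def)
  also have "\<dots> = (\<Sum>c\<in>transpositions n. \<Sum>d\<in>transpositions n. x c * y d * matsuo_basis_mult \<alpha> G c d g)"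
    using assms finite_transpositions[of n]
    by (intro sum.mono_neutral_left) (auto simp: matsuo_carrier_def)
  finally show "alg_mult (matsuo_algebra \<alpha> G (transpositions n)) x y g = \<dots>" .
qed

text \<open>Both sides are bilinear in x and y, so the claim reduces to
  \<open>axis_entry_jordan_mult\<close> for each pair c, d.\<close>

lemma matsuo_to_mat_mult:
  assumes two: "(2 :: 'f::field) \<noteq> 0"
    and x: "x \<in> matsuo_carrier (transpositions n)" and y: "y \<in> matsuo_carrier (transpositions n)"
  shows "matsuo_to_mat n (alg_mult (matsuo_algebra (1 / 2 :: 'f) (sym_group n) (transpositions n)) x y) =
    (1 / 2) \<cdot>\<^sub>m (matsuo_to_mat n x * matsuo_to_mat n y + matsuo_to_mat n y * matsuo_to_mat n x)"
proof (rule eq_matI; (simp add: matsuo_to_mat_def; fail)?)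
  let ?T = "transpositions n" and ?P = "axis_entry :: _ \<Rightarrow> _ \<Rightarrow> _ \<Rightarrow> 'f"
  fix i j assume "i < dim_row ((1 / 2) \<cdot>\<^sub>m (matsuo_to_mat n x * matsuo_to_mat n y + matsuo_to_mat n y * matsuo_to_mat n x))"
    "j < dim_col ((1 / 2) \<cdot>\<^sub>m (matsuo_to_mat n x * matsuo_to_mat n y + matsuo_to_mat n y * matsuo_to_mat n x))"
  hence ij: "i < n" "j < n" by (simp_all add: matsuo_to_mat_def)
  \<comment> \<open>\<open>?q c d\<close> is the entry of the ordinary product of the matrices of c
    and d, with the middle index summed out.\<close>
  let ?q = "\<lambda>c d. (?P d (Suc i) (Suc j) - ?P d (c (Suc i)) (Suc j)) / 2"
  have prod: "(matsuo_to_mat n u * matsuo_to_mat n v) $$ (i, j) =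
      (\<Sum>c\<in>?T. \<Sum>d\<in>?T. u c * v d * ?q c d)" for u v
  proof -
    have "(matsuo_to_mat n u * matsuo_to_mat n v) $$ (i, j) =
      (\<Sum>k<n. (\<Sum>c\<in>?T. u c * ?P c (Suc i) (Suc k)) * (\<Sum>d\<in>?T. v d * ?P d (Suc k) (Suc j)))"
      using ij by (simp add: matsuo_to_mat_def scalar_prod_def atLeast0LessThan)
    also have "\<dots> = (\<Sum>k<n. \<Sum>c\<in>?T. \<Sum>d\<in>?T. u c * v d * (?P c (Suc i) (Suc k) * ?P d (Suc k) (Suc j)))"
      by (simp add: sum_product mult_ac)
    also have "\<dots> = (\<Sum>c\<in>?T. \<Sum>k<n. \<Sum>d\<in>?T. u c * v d * (?P c (Suc i) (Suc k) * ?P d (Suc k) (Suc j)))"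
      by (rule sum.swap)
    also have "\<dots> = (\<Sum>c\<in>?T. \<Sum>d\<in>?T. \<Sum>k<n. u c * v d * (?P c (Suc i) (Suc k) * ?P d (Suc k) (Suc j)))"
      by (intro sum.cong refl sum.swap)
    also have "\<dots> = (\<Sum>c\<in>?T. \<Sum>d\<in>?T. u c * v d * ?q c d)"
      using ij sum_axis_entry_mult[of _ n "Suc i" "\<lambda>m. ?P _ m (Suc j)"]
      by (intro sum.cong refl) (simp only: sum_distrib_left[symmetric] atLeastAtMost_iff, simp)
    finally show ?thesis .
  qed
  have "((1 / 2) \<cdot>\<^sub>m (matsuo_to_mat n x * matsuo_to_mat n y + matsuo_to_mat n y * matsuo_to_mat n x)) $$ (i, j)
     = ((matsuo_to_mat n x * matsuo_to_mat n y) $$ (i, j) + (matsuo_to_mat n y * matsuo_to_mat n x) $$ (i, j)) / 2"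
    using ij by (simp add: matsuo_to_mat_def)
  also have "\<dots> = ((\<Sum>c\<in>?T. \<Sum>d\<in>?T. x c * y d * ?q c d) + (\<Sum>d\<in>?T. \<Sum>c\<in>?T. y d * x c * ?q d c)) / 2"
    by (simp only: prod)
  \<comment> \<open>With both double sums in the same order, \<open>?q c d\<close> meets
    \<open>?q d c\<close> and the product becomes symmetrised.\<close>
  also have "\<dots> = ((\<Sum>c\<in>?T. \<Sum>d\<in>?T. x c * y d * ?q c d) + (\<Sum>c\<in>?T. \<Sum>d\<in>?T. y d * x c * ?q d c)) / 2"
    by (subst sum.swap[of _ ?T ?T]) (rule refl)
  also have "\<dots> = (\<Sum>c\<in>?T. \<Sum>d\<in>?T. x c * y d * ((?q c d + ?q d c) / 2))"
    by (simp add: sum_divide_distrib sum.distrib[symmetric] algebra_simps add_divide_distrib diff_divide_distrib)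
  also have "\<dots> = (\<Sum>c\<in>?T. \<Sum>d\<in>?T. x c * y d *
     (\<Sum>e\<in>?T. matsuo_basis_mult (1 / 2) (sym_group n) c d e * ?P e (Suc i) (Suc j)))"
    by (intro sum.cong refl arg_cong2[where f = "(*)"] axis_entry_jordan_mult two)
  also have "\<dots> = (\<Sum>c\<in>?T. \<Sum>d\<in>?T. \<Sum>e\<in>?T. x c * y d *
     matsuo_basis_mult (1 / 2) (sym_group n) c d e * ?P e (Suc i) (Suc j))"
    by (simp add: sum_distrib_left mult_ac)
  \<comment> \<open>Moving e outermost collects the coefficient of e in the Matsuo product.\<close>
  also have "\<dots> = (\<Sum>c\<in>?T. \<Sum>e\<in>?T. \<Sum>d\<in>?T. x c * y d *
     matsuo_basis_mult (1 / 2) (sym_group n) c d e * ?P e (Suc i) (Suc j))"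
    by (intro sum.cong refl sum.swap)
  also have "\<dots> = (\<Sum>e\<in>?T. \<Sum>c\<in>?T. \<Sum>d\<in>?T. x c * y d *
     matsuo_basis_mult (1 / 2) (sym_group n) c d e * ?P e (Suc i) (Suc j))"
    by (rule sum.swap)
  also have "\<dots> = matsuo_to_mat n (alg_mult (matsuo_algebra (1 / 2) (sym_group n) ?T) x y) $$ (i, j)"
    using ij by (simp add: matsuo_algebra_mult_eq[OF x y] matsuo_to_mat_def sum_distrib_right)
  finally show "matsuo_to_mat n (alg_mult (matsuo_algebra (1 / 2) (sym_group n) ?T) x y) $$ (i, j) =
    ((1 / 2) \<cdot>\<^sub>m (matsuo_to_mat n x * matsuo_to_mat n y + matsuo_to_mat n y * matsuo_to_mat n x)) $$ (i, j)"
    by (rule sym)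
qed

section \<open>Off-diagonal entries as coordinates, and bijectivity\<close>

text \<open>Off the diagonal only the term \<open>of_bool (c i = j)\<close> survives, and a
  transposition is determined by one moved point and its image.\<close>

lemma matsuo_to_mat_off_diagonal:
  assumes "i < n" "j < n" "i \<noteq> j"
  shows "matsuo_to_mat n x $$ (i, j) = - x (transpose (Suc i) (Suc j)) / (2 :: 'f::field)"
proof -
  let ?t = "transpose (Suc i) (Suc j)"
  have t: "?t \<in> transpositions n" using assms by (force simp: transpositions_def)
  have "matsuo_to_mat n x $$ (i, j) = (\<Sum>c\<in>transpositions n. x c * axis_entry c (Suc i) (Suc j))"
    using assms by (simp add: matsuo_to_mat_def)
  also have "\<dots> = (\<Sum>c\<in>{?t}. x c * axis_entry c (Suc i) (Suc j))"
    using t assms finite_transpositions[of n]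
    by (intro sum.mono_neutral_right)
      (auto simp: axis_entry_def dest: transpositions_eq_transpose)
  also have "\<dots> = - x ?t / 2" using assms by (simp add: axis_entry_def)
  finally show ?thesis .
qed

lemma matsuo_to_mat_in_zero_sum:
  fixes x :: "(nat \<Rightarrow> nat) \<Rightarrow> 'f::field"
  shows "matsuo_to_mat n x \<in> zero_sum_sym_mats n"
proof -
  have "(\<Sum>j<n. matsuo_to_mat n x $$ (i, j)) = 0" if "i < n" for i
  proof -
    have "(\<Sum>j<n. matsuo_to_mat n x $$ (i, j)) =
       (\<Sum>j<n. \<Sum>c\<in>transpositions n. x c * axis_entry c (Suc i) (Suc j))"
      using that by (simp add: matsuo_to_mat_def)
    also have "\<dots> = (\<Sum>c\<in>transpositions n. \<Sum>j<n. x c * axis_entry c (Suc i) (Suc j))"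
      by (rule sum.swap)
    also have "\<dots> = 0"
    proof (rule sum.neutral, rule ballI)
      fix c assume "c \<in> transpositions n"
      \<comment> \<open>A row sum pairs the row with the constant vector 1, whose values at i and c
        i cancel.\<close>
      from sum_axis_entry_mult[OF this, of "Suc i" "\<lambda>_. 1 :: 'f"] that
      show "(\<Sum>j<n. x c * axis_entry c (Suc i) (Suc j)) = 0"
        by (simp only: sum_distrib_left[symmetric]) (simp add: Suc_le_eq)
    qed
    finally show ?thesis .
  qed
  moreover have "transpose_mat (matsuo_to_mat n x) = matsuo_to_mat n x"
    by (rule eq_matI) (auto simp: matsuo_to_mat_def intro!: sum.cong axis_entry_sym)
  ultimately show ?thesis by (simp add: zero_sum_sym_mats_def matsuo_to_mat_def)
qed

text \<open>A vanishing row sum expresses the diagonal entry through the rest of its row.\<close>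

lemma zero_sum_sym_mats_eqI:
  assumes X: "X \<in> zero_sum_sym_mats n" and Y: "Y \<in> zero_sum_sym_mats n"
    and off: "\<And>i j. i < n \<Longrightarrow> j < n \<Longrightarrow> i \<noteq> j \<Longrightarrow> X $$ (i, j) = Y $$ (i, j)"
  shows "X = Y"
proof (rule eq_matI)
  fix i j assume "i < dim_row Y" "j < dim_col Y"
  with Y have ij: "i < n" "j < n" by (auto simp: zero_sum_sym_mats_def)
  show "X $$ (i, j) = Y $$ (i, j)"
  proof (cases "i = j")
    case True
    have diag: "Z $$ (i, i) = - (\<Sum>k\<in>{..<n} - {i}. Z $$ (i, k))" if "Z \<in> zero_sum_sym_mats n" for Z
      using that ij sum.remove[of "{..<n}" i "\<lambda>k. Z $$ (i, k)"]
      by (simp add: zero_sum_sym_mats_def eq_neg_iff_add_eq_0)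
    show ?thesis using diag[OF X] diag[OF Y] off ij True by simp
  qed (use off ij in auto)
qed (use X Y in \<open>auto simp: zero_sum_sym_mats_def\<close>)

lemma bij_betw_matsuo_to_mat:
  assumes two: "(2 :: 'f::field) \<noteq> 0"
  shows "bij_betw (matsuo_to_mat n) (matsuo_carrier (transpositions n) :: (_ \<Rightarrow> 'f) set)
    (zero_sum_sym_mats n)"
  unfolding bij_betw_def
proof
  show "inj_on (matsuo_to_mat n) (matsuo_carrier (transpositions n) :: (_ \<Rightarrow> 'f) set)"
  proof (rule inj_onI, rule ext)
    fix x y :: "_ \<Rightarrow> 'f" and c
    assume x: "x \<in> matsuo_carrier (transpositions n)" and y: "y \<in> matsuo_carrier (transpositions n)"
      and eq: "matsuo_to_mat n x = matsuo_to_mat n y"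
    show "x c = y c"
    proof (cases "c \<in> transpositions n")
      case True
      then obtain a b where "c = transpose a b" "a \<in> {1..n}" "b \<in> {1..n}" "a \<noteq> b"
        by (auto simp: transpositions_def)
      then obtain i j where "c = transpose (Suc i) (Suc j)" "i < n" "j < n" "i \<noteq> j"
        by (cases a; cases b) auto
      with eq two matsuo_to_mat_off_diagonal[of i n j x] matsuo_to_mat_off_diagonal[of i n j y]
      show ?thesis by simp
    qed (use x y in \<open>simp add: matsuo_carrier_def\<close>)
  qed
  show "matsuo_to_mat n ` matsuo_carrier (transpositions n) = (zero_sum_sym_mats n :: 'f mat set)"
  proof (intro equalityI subsetI)
    fix X :: "'f mat" assume X: "X \<in> zero_sum_sym_mats n"
    \<comment> \<open>Either moved point may be chosen: the other choice reads the transposed entry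
      of X, which is equal by symmetry.\<close>
    define pt where "pt c = (SOME a. c a \<noteq> a)" for c :: "nat \<Rightarrow> nat"
    \<comment> \<open>The factor -2 inverts the -1/2 of \<open>matsuo_to_mat_off_diagonal\<close>;
      subtracting 1 turns points into matrix indices.\<close>
    define x where "x c = (if c \<in> transpositions n then - 2 * X $$ (pt c - 1, c (pt c) - 1) else 0)" for c
    have "finite {c. x c \<noteq> 0}"
      by (rule finite_subset[OF _ finite_transpositions[of n]]) (auto simp: x_def)
    hence "x \<in> matsuo_carrier (transpositions n)" by (simp add: matsuo_carrier_def x_def)
    moreover have "matsuo_to_mat n x = X"
    proof (rule zero_sum_sym_mats_eqI[OF matsuo_to_mat_in_zero_sum X])
      fix i j assume ij: "i < n" "j < n" "i \<noteq> j"
      let ?t = "transpose (Suc i) (Suc j)"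
      have t: "?t \<in> transpositions n" using ij by (force simp: transpositions_def)
      have "?t (pt ?t) \<noteq> pt ?t"
        unfolding pt_def by (rule someI[of _ "Suc i"]) (use ij in simp)
      hence "pt ?t = Suc i \<or> pt ?t = Suc j" by (metis transpose_apply_other)
      moreover have "X $$ (j, i) = X $$ (i, j)"
        using X ij index_transpose_mat(1)[of i X j] by (auto simp: zero_sum_sym_mats_def)
      ultimately have "x ?t = - 2 * X $$ (i, j)" using t by (auto simp: x_def)
      thus "matsuo_to_mat n x $$ (i, j) = X $$ (i, j)"
        using two by (simp add: matsuo_to_mat_off_diagonal[OF ij])
    qed
    ultimately show "X \<in> matsuo_to_mat n ` matsuo_carrier (transpositions n)" by blast
  qed (auto simp: matsuo_to_mat_in_zero_sum)
qed

section \<open>The isomorphism\<close>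

theorem theorem3p4:
  fixes n :: nat
  assumes "CHAR('f::field) \<noteq> 2"
    and "n \<ge> 1"
  shows "alg_isomorphic
           (matsuo_algebra (1 / 2 :: 'f) (sym_group n) (transpositions n))
           (zero_sum_jordan_algebra n)"
proof -
  have two: "(2 :: 'f) \<noteq> 0" by (rule two_neq_zero[OF assms(1)])
  let ?A = "matsuo_algebra (1 / 2 :: 'f) (sym_group n) (transpositions n)"
    and ?B = "zero_sum_jordan_algebra n :: ('f, 'f mat) alg"
  have carr: "alg_carrier ?A = matsuo_carrier (transpositions n)" "alg_carrier ?B = zero_sum_sym_mats n"
    by (simp_all add: matsuo_algebra_def zero_sum_jordan_algebra_def)
  have "matsuo_to_mat n (alg_add ?A x y) = alg_add ?B (matsuo_to_mat n x) (matsuo_to_mat n y)" for x y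
    by (rule eq_matI) (auto simp: matsuo_algebra_def zero_sum_jordan_algebra_def matsuo_to_mat_def
        distrib_right sum.distrib)
  moreover have "matsuo_to_mat n (alg_scale ?A a x) = alg_scale ?B a (matsuo_to_mat n x)" for a x
    by (rule eq_matI) (auto simp: matsuo_algebra_def zero_sum_jordan_algebra_def matsuo_to_mat_def
        sum_distrib_left mult.assoc)
  moreover have "matsuo_to_mat n (alg_mult ?A x y) = alg_mult ?B (matsuo_to_mat n x) (matsuo_to_mat n y)"
    if "x \<in> alg_carrier ?A" "y \<in> alg_carrier ?A" for x y
    using matsuo_to_mat_mult[OF two] that by (simp add: carr zero_sum_jordan_algebra_def)
  ultimately have "alg_iso ?A ?B (matsuo_to_mat n)"
    using bij_betw_matsuo_to_mat[OF two] by (simp add: alg_iso_def carr)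
  thus ?thesis by (auto simp: alg_isomorphic_def)
qed

end
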